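(* Let $f_1,\dots,f_n:\mathbb{R}^d\to\mathbb{R}$ be convex and differentiable, with $\nabla f_i$ being $L_i$-Lipschitz ($L_i>0$) in the Euclidean norm, let $R:\mathbb{R}^d\to\mathbb{R}$ be $\mu$-strongly convex with $\mu>0$, and let $x_*$ be the minimizer of $P=\frac1n\sum_{i=1}^n f_i+R$. Let $\widetilde x_0\in\mathbb{R}^d$, $\eta=4\bar L$ where $\bar L=\frac1n\sum_{i=1}^n L_i$, $m_1=\frac{\eta}{2\mu}$ (assumed to be a positive integer), $S\in\mathbb{N}$, and $\alpha=\frac14$. Then the iterates of the SVRDA algorithm (defined in the context) satisfy $$\mathbb{E}[P(\widetilde x_S)-P(x_* )]+\frac{3\mu}{2}\,\mathbb{E}\|\widetilde v_S-x_*\|^2\le\frac1{2^S}\Big[P(\widetilde x_0)-P(x_* )+\frac{3\mu}{2}\|\widetilde x_0-x_*\|^2\Big].$$ In addition, SVRDA has gradient complexity (defined in the context) $O\big((n+\frac{\bar L}{\mu})\log\frac1\varepsilon\big)$ for $\mathbb{E}[P(\widetilde x_S)-P(x_* )]\le\varepsilon$, and $O\big((n+\frac{\bar L}{\mu})\log\frac1{\mu\varepsilon}\big)$ for $\mathbb{E}\|\widetilde v_S-x_*\|^2\le\varepsilon$. That is, with $D=P(\widetilde x_0)-P(x_* )+\frac{3\mu}{2}\|\widetilde x_0-x_*\|^2$, there is a constant $C$ depending only on $D$ such that: for every $\varepsilon\in(0,\frac12]$ there is $S\ge1$ for which $\mathbb{E}[P(\widetilde x_S)-P(x_* )]\le\varepsilon$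 and the number of component gradient evaluations used in the first $S$ stages is at most $C(n+\frac{\bar L}{\mu})\log\frac1\varepsilon$; and for every $\varepsilon>0$ with $\mu\varepsilon\le\frac12$ there is $S\ge1$ for which $\mathbb{E}\|\widetilde v_S-x_*\|^2\le\varepsilon$ and that number is at most $C(n+\frac{\bar L}{\mu})\log\frac1{\mu\varepsilon}$.
   Context: All norms are Euclidean. $F=\frac1n\sum_{i=1}^n f_i$ and $P=F+R$. $R$ is $\mu$-strongly convex means $R(y)\ge R(x)+\xi^\top(y-x)+\frac{\mu}{2}\|y-x\|^2$ for all $x,y\in\mathbb{R}^d$ and all $\xi\in\partial R(x)$. $Q$ is the probability distribution on $\{1,\dots,n\}$ with weights $q_i=L_i/(n\bar L)$. SVRDA algorithm (case $\mu>0$) with inputs $\widetilde x_0\in\mathbb{R}^d$, $\eta>0$, $m_1$, and $\alpha$: set $\widetilde v_0=\widetilde x_0$. For stages $s=1,2,\dots$: put $x_0=\widetilde x_{s-1}$, $v_0=(1-\alpha)\widetilde v_{s-1}+\alpha\widetilde x_{s-1}$, $u_0=v_0$, $\bar g_0=0$, and $m_s=m_1$. For $t=1,\dots,m_s$: draw $i_t$ from $Q$ independently of all earlier draws (in this and previous stages) and set $$g_t=\frac{\nabla f_{i_t}(u_{t-1})-\nabla f_{i_t}(x_0)}{nq_{i_t}}+\nabla F(x_0),\qquad \bar g_t=\Big(1-\frac1t\Big)\bar g_{t-1}+\frac1t g_t,$$ $$v_t=\operatorname*{argmin}_{x\in\mathbb{R}^d}\Big\{\langle\bar g_t,x\rangle+R(x)+\frac{\eta}{2t}\|x-v_0\|^2\Big\},\qquad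 x_t=\operatorname*{argmin}_{x\in\mathbb{R}^d}\Big\{\langle g_t,x\rangle+R(x)+\frac{\eta t}{2}\|x-u_{t-1}\|^2\Big\},$$ $$u_t=\Big(1-\frac1{t+1}\Big)x_t+\frac1{t+1}v_t .$$ Finally put $\widetilde x_s=x_{m_s}$ and $\widetilde v_s=v_{m_s}$. The expectation $\mathbb{E}$ is over all random draws. Gradient complexity is the order of the number of evaluations of component gradients $\nabla f_i$ needed to reach the stated accuracy; stage $s$ costs $n$ evaluations for $\nabla F(x_0)$ plus $2$ per inner iteration, i.e. $n+2m_s$, so $S$ stages cost $\sum_{s=1}^S(n+2m_s)$. *)

theory Defs
  imports "HOL-Probability.Probability"
begin

text \<open>The Euclidean space R^d is rendered as an arbitrary type of class \<^class>\<open>euclidean_space\<close>.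
  For a differentiable real function \<open>grad f\<close> is the gradient; elsewhere it is unspecified.\<close>

definition grad :: "('a::euclidean_space \<Rightarrow> real) \<Rightarrow> 'a \<Rightarrow> 'a" where
  "grad f x = (THE g. GDERIV f x :> g)"

definition subdifferential :: "('a::euclidean_space \<Rightarrow> real) \<Rightarrow> 'a \<Rightarrow> 'a set" where
  "subdifferential R x = {\<xi>. \<forall>y. R y \<ge> R x + inner \<xi> (y - x)}"

text \<open>Convexity is part of the definition: the inequality alone holds vacuously for a nonconvex
  function all of whose subdifferentials are empty.\<close>

definition strongly_convex :: "real \<Rightarrow> ('a::euclidean_space \<Rightarrow> real) \<Rightarrow> bool" where
  "strongly_convex \<mu> R \<longleftrightarrow> convex_on UNIV R \<and>
     (\<forall>x y. \<forall>\<xi>\<in>subdifferential R x.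
        R y \<ge> R x + inner \<xi> (y - x) + \<mu> / 2 * (norm (y - x))\<^sup>2)"

definition minimizer :: "('a \<Rightarrow> real) \<Rightarrow> 'a \<Rightarrow> bool" where
  "minimizer f x \<longleftrightarrow> is_arg_min f (\<lambda>_. True) x"

definition argmin :: "('a \<Rightarrow> real) \<Rightarrow> 'a" where
  "argmin f = arg_min f (\<lambda>_. True)"

definition finite_avg :: "nat \<Rightarrow> (nat \<Rightarrow> 'a \<Rightarrow> real) \<Rightarrow> 'a \<Rightarrow> real" where
  "finite_avg n f x = (\<Sum>k=1..n. f k x) / real n"

definition Lbar :: "nat \<Rightarrow> (nat \<Rightarrow> real) \<Rightarrow> real" where
  "Lbar n L = (\<Sum>k=1..n. L k) / real n"

definition q_weight :: "nat \<Rightarrow> (nat \<Rightarrow> real) \<Rightarrow> nat \<Rightarrow> real" where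
  "q_weight n L k = L k / (real n * Lbar n L)"

definition Q_dist :: "nat \<Rightarrow> (nat \<Rightarrow> real) \<Rightarrow> nat measure" where
  "Q_dist n L = point_measure {1..n} (\<lambda>k. ennreal (q_weight n L k))"

text \<open>The algorithm is a deterministic function of the realized draws. Inside a stage the draws are
  \<open>i 1, i 2, \<dots>\<close>, and \<open>svrda_inner \<dots> t\<close> is the tuple of the values, after \<open>t\<close> iterations, of
  the averaged gradient estimate (\<open>gbar\<close>), \<open>x\<close>, \<open>v\<close> and \<open>u\<close>.\<close>

definition vr_gradient ::
  "nat \<Rightarrow> (nat \<Rightarrow> 'a::euclidean_space \<Rightarrow> real) \<Rightarrow> (nat \<Rightarrow> real) \<Rightarrow> 'a \<Rightarrow> 'a \<Rightarrow> nat \<Rightarrow> 'a" where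
  "vr_gradient n f L x0 u k =
     (1 / (real n * q_weight n L k)) *\<^sub>R (grad (f k) u - grad (f k) x0) + grad (finite_avg n f) x0"

primrec svrda_inner ::
  "nat \<Rightarrow> (nat \<Rightarrow> 'a::euclidean_space \<Rightarrow> real) \<Rightarrow> (nat \<Rightarrow> real) \<Rightarrow> ('a \<Rightarrow> real) \<Rightarrow> real \<Rightarrow>
   'a \<Rightarrow> 'a \<Rightarrow> (nat \<Rightarrow> nat) \<Rightarrow> nat \<Rightarrow> 'a \<times> 'a \<times> 'a \<times> 'a" where
  "svrda_inner n f L R \<eta> x0 v0 i 0 = (0, x0, v0, v0)"
| "svrda_inner n f L R \<eta> x0 v0 i (Suc t') =
     (let (gbar, x, v, u) = svrda_inner n f L R \<eta> x0 v0 i t';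
          t = real (Suc t');
          g = vr_gradient n f L x0 u (i (Suc t'));
          gbar' = (1 - 1 / t) *\<^sub>R gbar + (1 / t) *\<^sub>R g;
          v' = argmin (\<lambda>z. inner gbar' z + R z + \<eta> / (2 * t) * (norm (z - v0))\<^sup>2);
          x' = argmin (\<lambda>z. inner g z + R z + \<eta> * t / 2 * (norm (z - u))\<^sup>2);
          u' = (1 - 1 / (t + 1)) *\<^sub>R x' + (1 / (t + 1)) *\<^sub>R v'
      in (gbar', x', v', u'))"

text \<open>\<open>svrda \<dots> i s\<close> is the pair of the stage outputs (\<open>xtilde s\<close>, \<open>vtilde s\<close>); \<open>i s t\<close> is the draw
  of iteration \<open>t\<close> of stage \<open>s\<close>, with stages and iterations counted from 1.\<close>

primrec svrda ::
  "nat \<Rightarrow> (nat \<Rightarrow> 'a::euclidean_space \<Rightarrow> real) \<Rightarrow> (nat \<Rightarrow> real) \<Rightarrow> ('a \<Rightarrow> real) \<Rightarrow>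
   'a \<Rightarrow> real \<Rightarrow> nat \<Rightarrow> real \<Rightarrow> (nat \<Rightarrow> nat \<Rightarrow> nat) \<Rightarrow> nat \<Rightarrow> 'a \<times> 'a" where
  "svrda n f L R xt0 \<eta> m1 \<alpha> i 0 = (xt0, xt0)"
| "svrda n f L R xt0 \<eta> m1 \<alpha> i (Suc s) =
     (let (xt, vt) = svrda n f L R xt0 \<eta> m1 \<alpha> i s;
          (gbar, x, v, u) =
            svrda_inner n f L R \<eta> xt ((1 - \<alpha>) *\<^sub>R vt + \<alpha> *\<^sub>R xt) (i (Suc s)) m1
      in (x, v))"

text \<open>\<open>I s t\<close> is the random draw of iteration \<open>t\<close> of stage \<open>s\<close>.\<close>

definition svrda_draws ::
  "'w measure \<Rightarrow> nat \<Rightarrow> (nat \<Rightarrow> real) \<Rightarrow> nat \<Rightarrow> (nat \<Rightarrow> nat \<Rightarrow> 'w \<Rightarrow> nat) \<Rightarrow> bool" where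
  "svrda_draws M n L m1 I \<longleftrightarrow>
     prob_space.indep_vars M (\<lambda>_. count_space {1..n}) (\<lambda>(s, t). I s t) ({1..} \<times> {1..m1}) \<and>
     (\<forall>s\<ge>1. \<forall>t\<in>{1..m1}. distr M (count_space {1..n}) (I s t) = Q_dist n L)"

definition gradient_evaluations :: "nat \<Rightarrow> nat \<Rightarrow> nat \<Rightarrow> nat" where
  "gradient_evaluations n m1 S = (\<Sum>s=1..S. n + 2 * m1)"

text \<open>The constant \<open>C\<close> of the complexity bounds, which may depend on \<open>D\<close> only. An existential
  quantifier over \<open>C\<close> in a theorem could not precede the quantification over types, so \<open>C\<close> might
  depend on the dimension; a closed function from reals to reals cannot.\<close>

definition complexity_const :: "real \<Rightarrow> real" where
  "complexity_const D = 16 * (1 + D)"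

end

theory Submission
  imports Defs
begin

text \<open>A stage halves, in expectation, the potential
  \<open>P x - P xstar + 3 * \<mu> / 2 * (norm (v - xstar))\<^sup>2\<close> of its pair \<open>(x, v)\<close>, and everything else
  follows from this by iteration.

  Inside a stage, \<open>v t\<close> minimizes the estimate function \<open>\<psi> t\<close> of regularized dual averaging: the sum of
  the linearizations of \<open>F\<close> seen so far, with estimated gradients, plus \<open>t * R\<close> and a quadratic term
  around the start point. The point \<open>u t\<close> is a convex combination of \<open>x t\<close> and \<open>v t\<close>, so replacing
  \<open>v t\<close> by \<open>v (Suc t)\<close> in it gives a competitor for the proximal step that produces
  \<open>x (Suc t)\<close>. This shows that \<open>t * P (x t)\<close> grows at most as fast as the minimum of \<open>\<psi> t\<close>, up to
  the errors of the gradient estimates (\<open>x_step\<close>). Summing and evaluating \<open>\<psi>\<close> at \<open>xstar\<close> bounds the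
  last iterate (\<open>stage_bound\<close>).

  In this bound an iteration contributes the squared error of the gradient estimate divided by
  \<open>6 * Lbar n L\<close>, a term of mean 0, and \<open>- bregman F u xstar\<close>, the slack in the convexity inequality
  of \<open>F\<close> between \<open>u\<close> and \<open>xstar\<close>. By co-coercivity of the gradients the variance is bounded by
  Bregman divergences at \<open>u\<close> and at \<open>x0\<close>. The former is cancelled by the slack; half of the latter
  remains, and is at most half of \<open>P x0 - P xstar - \<mu> / 2 * (norm (x0 - xstar))\<^sup>2\<close>
  (\<open>mean_step_error\<close>). Since the stage length is \<open>2 * Lbar n L / \<mu>\<close> and the stage starts its
  \<open>v\<close> sequence at \<open>3/4 * v + 1/4 * x\<close>, the quadratic terms at \<open>x\<close> cancel and those at \<open>v\<close> are
  halved (\<open>potential_Suc_le\<close>).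

  The bound of a stage holds for every sequence of draws, so probability enters only when an error
  term is averaged over its own draw, which is independent of all earlier ones
  (\<open>expectation_independent_draw\<close>). All random quantities are functions of finitely many draws from a
  finite set, hence integrable.

  For the complexity, \<open>S\<close> stages cost \<open>S * (n + 4 * Lbar n L / \<mu>)\<close>, and a number of stages of the order
  of the logarithm of the inverse accuracy suffices (\<open>few_halvings\<close>). As the potential
  contains the squared distance with a factor of the order of \<open>\<mu>\<close>, the accuracy \<open>\<epsilon>\<close> for the
  distance takes as many stages as the accuracy \<open>\<mu> * \<epsilon>\<close> for the gap.\<close>

section \<open>Gradients and subgradients\<close>

lemma GDERIV_unique:
  assumes "GDERIV f x :> a" and "GDERIV f x :> b"
  shows "a = b"
proof -
  have "(\<lambda>h. inner h a) = (\<lambda>h. inner h b)"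
    using assms unfolding gderiv_def by (rule has_derivative_unique)
  then have "inner (a - b) a = inner (a - b) b"
    by (rule fun_cong)
  then have "inner (a - b) (a - b) = 0"
    by (simp add: inner_diff_right)
  then show ?thesis by simp
qed

lemma grad_eqI: "GDERIV f x :> g \<Longrightarrow> grad f x = g"
  unfolding grad_def by (blast intro: the_equality GDERIV_unique)

lemma GDERIV_grad:
  fixes f :: "'a::euclidean_space \<Rightarrow> real"
  assumes "f differentiable (at x)"
  shows "GDERIV f x :> grad f x"
proof -
  obtain f' where f': "(f has_derivative f') (at x)"
    using assms by (auto simp: differentiable_def)
  then interpret f': bounded_linear f' by (rule has_derivative_bounded_linear)
  have "f' h = inner h (\<Sum>b\<in>Basis. f' b *\<^sub>R b)" for h
  proof -
    have "f' h = f' (\<Sum>b\<in>Basis. inner h b *\<^sub>R b)"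
      by (simp add: euclidean_representation)
    also have "\<dots> = (\<Sum>b\<in>Basis. inner h b * f' b)"
      by (simp add: f'.sum f'.scaleR)
    also have "\<dots> = inner h (\<Sum>b\<in>Basis. f' b *\<^sub>R b)"
      by (simp add: inner_sum_right mult.commute)
    finally show ?thesis .
  qed
  then have "f' = (\<lambda>h. inner h (\<Sum>b\<in>Basis. f' b *\<^sub>R b))"
    by (rule ext)
  with f' have "GDERIV f x :> (\<Sum>b\<in>Basis. f' b *\<^sub>R b)"
    unfolding gderiv_def by metis
  then show ?thesis
    using grad_eqI by metis
qed

lemma GDERIV_along_line:
  assumes "GDERIV G (z + t *\<^sub>R e) :> d"
  shows "((\<lambda>h. G (z + h *\<^sub>R e)) has_field_derivative inner e d) (at t)"
proof -
  have "((\<lambda>h. z + h *\<^sub>R e) has_derivative (\<lambda>h. h *\<^sub>R e)) (at t)"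
    by (auto intro!: derivative_eq_intros)
  from has_derivative_compose[OF this assms[unfolded gderiv_def]]
  have "((\<lambda>h. G (z + h *\<^sub>R e)) has_derivative (\<lambda>h. inner (h *\<^sub>R e) d)) (at t)" .
  then show ?thesis
    by (simp add: has_field_derivative_def mult_commute_abs)
qed

text \<open>Move from the minimizer \<open>z\<close> a fraction \<open>h\<close> of the way towards \<open>y\<close>: convexity bounds the growth
  of \<open>R\<close> by \<open>h * (R y - R z)\<close>, minimality makes this at least the decrease of \<open>G\<close>, and dividing by
  \<open>h\<close> leaves the directional derivative of \<open>G\<close> in the limit.\<close>

lemma subgradient_of_minimizer:
  fixes G R :: "'a::euclidean_space \<Rightarrow> real"
  assumes cvx: "convex_on UNIV R" and G: "GDERIV G z :> d"
    and min: "\<And>y. G z + R z \<le> G y + R y"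
  shows "- d \<in> subdifferential R z"
  unfolding subdifferential_def
proof safe
  fix y
  define e where "e = y - z"
  have "((\<lambda>h. G (z + h *\<^sub>R e)) has_field_derivative inner e d) (at 0)"
    using G by (intro GDERIV_along_line) simp
  then have "((\<lambda>h. (G (z + h *\<^sub>R e) - G z) / h) \<longlongrightarrow> inner e d) (at 0)"
    by (simp add: DERIV_def)
  then have lim: "((\<lambda>h. (G (z + h *\<^sub>R e) - G z) / h) \<longlongrightarrow> inner e d) (at_right 0)"
    by (rule tendsto_within_subset) simp
  have bound: "- (R y - R z) \<le> (G (z + h *\<^sub>R e) - G z) / h" if h: "0 < h" "h < 1" for h
  proof -
    have "R (z + h *\<^sub>R e) \<le> (1 - h) * R z + h * R y"
      using convex_onD[OF cvx, of h z y] h by (simp add: e_def algebra_simps)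
    with min[of "z + h *\<^sub>R e"]
    have "- (R y - R z) * h \<le> G (z + h *\<^sub>R e) - G z" by (simp add: algebra_simps)
    then show ?thesis using h by (simp add: pos_le_divide_eq)
  qed
  have "\<forall>\<^sub>F h in at_right 0. - (R y - R z) \<le> (G (z + h *\<^sub>R e) - G z) / h"
    using bound by (auto simp: eventually_at_right_field intro!: exI[of _ 1])
  from tendsto_lowerbound[OF lim this] have "- (R y - R z) \<le> inner e d"
    by simp
  then show "R z + inner (- d) (y - z) \<le> R y"
    by (simp add: e_def inner_commute)
qed

text \<open>Every point minimizes \<open>- f + f\<close>, so the first-order characterization of convexity is a case of
  the optimality condition.\<close>

lemma convex_grad_le:
  fixes f :: "'a::euclidean_space \<Rightarrow> real"
  assumes "convex_on UNIV f" and "f differentiable (at x)"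
  shows "f x + inner (grad f x) (y - x) \<le> f y"
proof -
  have "GDERIV (\<lambda>z. - f z) x :> - grad f x"
    using GDERIV_grad[OF assms(2)] by (rule GDERIV_minus)
  from subgradient_of_minimizer[OF assms(1) this]
  show ?thesis by (simp add: subdifferential_def)
qed

section \<open>Smooth convex functions\<close>

lemma lipschitz_grad_upper_bound:
  fixes f :: "'a::euclidean_space \<Rightarrow> real"
  assumes diff: "\<And>x. f differentiable (at x)" and lip: "K-lipschitz_on UNIV (grad f)"
  shows "f y \<le> f x + inner (grad f x) (y - x) + K / 2 * (norm (y - x))\<^sup>2"
proof -
  define e where "e = y - x"
  define \<phi> where "\<phi> h = f (x + h *\<^sub>R e) - h * inner (grad f x) e - K / 2 * h\<^sup>2 * (norm e)\<^sup>2" for h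
  have "\<phi> 1 \<le> \<phi> 0"
  proof (rule DERIV_nonpos_imp_nonincreasing[where f = \<phi>])
    fix h :: real assume h: "0 \<le> h" "h \<le> 1"
    let ?D = "inner e (grad f (x + h *\<^sub>R e)) - inner (grad f x) e - K * h * (norm e)\<^sup>2"
    have "((\<lambda>h. f (x + h *\<^sub>R e)) has_field_derivative inner e (grad f (x + h *\<^sub>R e))) (at h)"
      by (intro GDERIV_along_line GDERIV_grad diff)
    then have "DERIV \<phi> h :> ?D"
      unfolding \<phi>_def by (auto intro!: derivative_eq_intros)
    moreover have "?D \<le> 0"
    proof -
      have "inner e (grad f (x + h *\<^sub>R e) - grad f x) \<le> norm e * norm (grad f (x + h *\<^sub>R e) - grad f x)"
        by (rule norm_cauchy_schwarz)
      also have "\<dots> \<le> norm e * (K * (h * norm e))"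
        using lipschitz_onD[OF lip, of "x + h *\<^sub>R e" x] h
        by (intro mult_left_mono) (auto simp: dist_norm)
      finally show ?thesis
        by (simp add: inner_diff_right inner_commute power2_eq_square algebra_simps)
    qed
    ultimately show "\<exists>D. DERIV \<phi> h :> D \<and> D \<le> 0" by blast
  qed simp
  then show ?thesis
    by (simp add: \<phi>_def e_def)
qed

text \<open>The convex function \<open>f - inner (grad f x)\<close> is minimal at \<open>x\<close>, hence not smaller at the point
  reached from \<open>y\<close> by a gradient step of size \<open>1 / K\<close>, whereas by smoothness this step decreases
  it by at least \<open>1 / (2 K)\<close> times the squared norm of its gradient
  \<open>grad f y - grad f x\<close>.\<close>

lemma grad_diff_le_bregman:
  fixes f :: "'a::euclidean_space \<Rightarrow> real"
  assumes cvx: "convex_on UNIV f" and diff: "\<And>x. f differentiable (at x)"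
    and lip: "K-lipschitz_on UNIV (grad f)" and K: "K > 0"
  shows "(norm (grad f y - grad f x))\<^sup>2 \<le> 2 * K * (f y - f x - inner (grad f x) (y - x))"
proof -
  define d where "d = grad f y - grad f x"
  define z where "z = y - (1 / K) *\<^sub>R d"
  have "f z \<le> f y + inner (grad f y) (z - y) + K / 2 * (norm (z - y))\<^sup>2"
    by (rule lipschitz_grad_upper_bound[OF diff lip])
  moreover have "f x + inner (grad f x) (z - x) \<le> f z"
    by (rule convex_grad_le[OF cvx diff])
  moreover have "inner (grad f x) (z - x) = inner (grad f x) (y - x) - inner (grad f x) d / K"
    by (simp add: z_def inner_diff_right)
  moreover have "inner (grad f y) (z - y) = - (inner (grad f y) d / K)"
    by (simp add: z_def)
  moreover have "K / 2 * (norm (z - y))\<^sup>2 = (norm d)\<^sup>2 / (2 * K)"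
    using K by (simp add: z_def power2_eq_square)
  moreover have "inner (grad f y) d / K - inner (grad f x) d / K = (norm d)\<^sup>2 / K"
    by (simp add: d_def inner_diff_left power2_norm_eq_inner diff_divide_distrib)
  moreover have "(norm d)\<^sup>2 / K = 2 * ((norm d)\<^sup>2 / (2 * K))"
    by simp
  ultimately have "(norm d)\<^sup>2 / (2 * K) \<le> f y - f x - inner (grad f x) (y - x)"
    by linarith
  then show ?thesis
    using K by (simp add: d_def pos_divide_le_eq mult.commute)
qed

section \<open>Proximal steps\<close>

text \<open>A subgradient gives an affine minorant of \<open>R\<close>, against which the quadratic term wins far away;
  so a minimizer is found on a ball.\<close>

lemma prox_minimizer_exists:
  fixes R :: "'a::euclidean_space \<Rightarrow> real"
  assumes cvx: "convex_on UNIV R" and sub: "\<xi> \<in> subdifferential R p" and c: "c > 0"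
  shows "\<exists>z. \<forall>y. inner g z + R z + c * (norm (z - w))\<^sup>2 \<le> inner g y + R y + c * (norm (y - w))\<^sup>2"
proof -
  define \<phi> where "\<phi> z = inner g z + R z + c * (norm (z - w))\<^sup>2" for z
  define k where "k = norm (\<xi> + g)"
  define b where "b = R w - R p - inner \<xi> (w - p)"
  define r where "r = max 1 ((k + b) / c)"
  have b: "0 \<le> b"
    using sub by (simp add: subdifferential_def b_def algebra_simps)
  have far: "\<phi> w \<le> \<phi> z" if z: "r < norm (z - w)" for z
  proof -
    let ?d = "norm (z - w)"
    have d1: "1 \<le> ?d" and d2: "k + b \<le> c * ?d"
      using z c by (auto simp: r_def pos_divide_less_eq mult.commute)
    have "R p + inner \<xi> (z - p) \<le> R z"
      using sub by (simp add: subdifferential_def)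
    moreover have "- (inner (\<xi> + g) (z - w)) \<le> k * ?d"
      using norm_cauchy_schwarz[of "- (\<xi> + g)" "z - w"]
      unfolding k_def norm_minus_cancel inner_minus_left .
    ultimately have "\<phi> w - \<phi> z \<le> b + k * ?d - c * ?d\<^sup>2"
      by (simp add: \<phi>_def b_def inner_diff_right inner_add_left)
    also have "\<dots> \<le> b * ?d + k * ?d - c * ?d\<^sup>2"
      using mult_left_mono[OF d1 b] by simp
    also have "\<dots> = ?d * (k + b - c * ?d)"
      by (simp add: algebra_simps power2_eq_square)
    also have "\<dots> \<le> 0"
      using d1 d2 by (intro mult_nonneg_nonpos) auto
    finally show ?thesis by simp
  qed
  have "continuous_on (cball w r) R"
    using convex_on_continuous[OF open_UNIV cvx] by (rule continuous_on_subset) simp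
  then have "continuous_on (cball w r) \<phi>"
    unfolding \<phi>_def by (intro continuous_intros)
  moreover have "w \<in> cball w r"
    by (simp add: r_def)
  ultimately obtain z where z: "z \<in> cball w r" "\<And>y. y \<in> cball w r \<Longrightarrow> \<phi> z \<le> \<phi> y"
    using continuous_attains_inf[of "cball w r" \<phi>] by auto
  have "\<phi> z \<le> \<phi> y" for y
  proof (cases "y \<in> cball w r")
    case False
    then have "\<phi> w \<le> \<phi> y"
      by (intro far) (simp add: dist_norm norm_minus_commute)
    with z(2)[OF \<open>w \<in> cball w r\<close>] show ?thesis by simp
  qed (rule z)
  then show ?thesis unfolding \<phi>_def by blast
qed

text \<open>At the minimizer, the negative gradient of the smooth part is a subgradient of \<open>R\<close>. Strong
  convexity of \<open>R\<close> for this subgradient, added to the exact expansion of the quadratic term, leaves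
  both moduli. An arbitrary subgradient \<open>\<xi>\<close> of \<open>R\<close> serves to obtain the minimizer.\<close>

lemma prox_argmin:
  fixes R :: "'a::euclidean_space \<Rightarrow> real" and g w p \<xi> :: 'a
  assumes sc: "strongly_convex \<mu> R" and sub: "\<xi> \<in> subdifferential R p" and c: "c > 0"
  defines "\<phi> \<equiv> \<lambda>z. inner g z + R z + c * (norm (z - w))\<^sup>2"
  shows "\<phi> (argmin \<phi>) + (c + \<mu> / 2) * (norm (y - argmin \<phi>))\<^sup>2 \<le> \<phi> y"
proof -
  have cvx: "convex_on UNIV R"
    using sc by (simp add: strongly_convex_def)
  define z where "z = argmin \<phi>"
  have "is_arg_min \<phi> (\<lambda>_. True) z"
    using prox_minimizer_exists[OF cvx sub c, of g w]
    unfolding z_def argmin_def arg_min_def \<phi>_def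
    by (rule_tac someI_ex) (simp add: is_arg_min_linorder)
  then have min: "\<phi> z \<le> \<phi> y" for y
    by (simp add: is_arg_min_linorder)
  define d where "d = g + (2 * c) *\<^sub>R (z - w)"
  have "GDERIV (\<lambda>z. inner g z + c * (norm (z - w))\<^sup>2) z :> d"
    unfolding gderiv_def d_def power2_norm_eq_inner
    by (rule derivative_eq_intros refl | simp add: algebra_simps inner_commute)+
  then have "- d \<in> subdifferential R z"
    using min by (intro subgradient_of_minimizer[OF cvx]) (auto simp: \<phi>_def algebra_simps)
  then have "R z + inner (- d) (y - z) + \<mu> / 2 * (norm (y - z))\<^sup>2 \<le> R y"
    using sc unfolding strongly_convex_def by blast
  moreover have "c * (norm (y - w))\<^sup>2
      = c * (norm (z - w))\<^sup>2 + 2 * c * inner (z - w) (y - z) + c * (norm (y - z))\<^sup>2"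
    unfolding power2_norm_eq_inner by (simp add: algebra_simps inner_commute)
  ultimately show ?thesis
    unfolding z_def[symmetric]
    by (simp add: \<phi>_def d_def algebra_simps inner_add_left inner_diff_right)
qed

section \<open>The importance-weighted gradient estimate\<close>

definition bregman :: "('a::euclidean_space \<Rightarrow> real) \<Rightarrow> 'a \<Rightarrow> 'a \<Rightarrow> real" where
  "bregman G x y = G y - G x - inner (grad G x) (y - x)"

text \<open>The weighted sum of squared distances to \<open>c\<close> exceeds that to the mean \<open>b\<close> by exactly
  \<open>(norm (b - c))\<^sup>2\<close>.\<close>

lemma weighted_variance_le:
  fixes a :: "'k \<Rightarrow> 'a::euclidean_space"
  assumes one: "(\<Sum>k\<in>A. q k) = (1::real)" and mean: "(\<Sum>k\<in>A. q k *\<^sub>R a k) = b"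
  shows "(\<Sum>k\<in>A. q k * (norm (a k - b))\<^sup>2) \<le> (\<Sum>k\<in>A. q k * (norm (a k - c))\<^sup>2)"
proof -
  have sq: "(norm (a k - c))\<^sup>2 = (norm (a k - b))\<^sup>2 + 2 * inner (a k) (b - c) - 2 * inner b (b - c) + (norm (b - c))\<^sup>2" for k
    unfolding power2_norm_eq_inner by (simp add: algebra_simps inner_commute)
  have "(\<Sum>k\<in>A. q k * inner (a k) (b - c)) = inner b (b - c)"
    unfolding mean[symmetric] by (simp add: inner_sum_left)
  then have lin: "(\<Sum>k\<in>A. q k * (2 * inner (a k) (b - c))) = 2 * inner b (b - c)"
    by (simp add: sum_distrib_left[symmetric] mult.left_commute[of _ 2])
  have "(\<Sum>k\<in>A. q k * (norm (a k - c))\<^sup>2) = (\<Sum>k\<in>A. q k * (norm (a k - b))\<^sup>2)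
      + (\<Sum>k\<in>A. q k * (2 * inner (a k) (b - c))) - (\<Sum>k\<in>A. q k) * (2 * inner b (b - c))
      + (\<Sum>k\<in>A. q k) * (norm (b - c))\<^sup>2"
    unfolding sq sum_distrib_right sum.distrib[symmetric] sum_subtractf[symmetric]
    by (simp add: algebra_simps)
  also have "\<dots> = (\<Sum>k\<in>A. q k * (norm (a k - b))\<^sup>2) + (norm (b - c))\<^sup>2"
    by (simp add: lin one)
  finally show ?thesis by simp
qed

locale svrda_problem =
  fixes n :: nat and f :: "nat \<Rightarrow> 'a::euclidean_space \<Rightarrow> real" and L :: "nat \<Rightarrow> real"
    and R :: "'a \<Rightarrow> real" and \<mu> :: real and xstar :: 'a
  assumes n: "n \<ge> 1"
    and cvx: "\<And>k. k \<in> {1..n} \<Longrightarrow> convex_on UNIV (f k)"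
    and diff: "\<And>k x. k \<in> {1..n} \<Longrightarrow> f k differentiable (at x)"
    and L_pos: "\<And>k. k \<in> {1..n} \<Longrightarrow> L k > 0"
    and lip: "\<And>k. k \<in> {1..n} \<Longrightarrow> (L k)-lipschitz_on UNIV (grad (f k))"
    and \<mu>: "\<mu> > 0" and R: "strongly_convex \<mu> R"
    and xstar: "minimizer (\<lambda>x. finite_avg n f x + R x) xstar"
begin

abbreviation F :: "'a \<Rightarrow> real" where "F \<equiv> finite_avg n f"
abbreviation P :: "'a \<Rightarrow> real" where "P x \<equiv> F x + R x"
abbreviation Lb :: real where "Lb \<equiv> Lbar n L"
abbreviation q :: "nat \<Rightarrow> real" where "q \<equiv> q_weight n L"

lemma P_ge: "P xstar \<le> P x"
  using xstar by (simp add: minimizer_def is_arg_min_linorder)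

lemma Lb_pos: "Lb > 0"
  unfolding Lbar_def using n L_pos by (intro divide_pos_pos sum_pos) auto

lemma q_nonneg: "k \<in> {1..n} \<Longrightarrow> q k \<ge> 0"
  unfolding q_weight_def using L_pos[of k] Lb_pos by auto

lemma sum_q: "(\<Sum>k=1..n. q k) = 1"
proof -
  have "(\<Sum>k=1..n. q k) = (\<Sum>k=1..n. L k) / (real n * Lb)"
    unfolding q_weight_def by (simp add: sum_divide_distrib)
  also have "(\<Sum>k=1..n. L k) = real n * Lb"
    using n by (simp add: Lbar_def)
  finally show ?thesis using n Lb_pos by simp
qed

lemma GDERIV_F: "GDERIV F x :> (1 / real n) *\<^sub>R (\<Sum>k=1..n. grad (f k) x)"
proof -
  have "((\<lambda>x. (\<Sum>k=1..n. f k x)) has_derivative (\<lambda>h. \<Sum>k=1..n. inner h (grad (f k) x))) (at x)"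
    by (rule has_derivative_sum) (use GDERIV_grad[OF diff] in \<open>simp add: gderiv_def\<close>)
  then have "((\<lambda>x. (\<Sum>k=1..n. f k x) / real n) has_derivative
      (\<lambda>h. (\<Sum>k=1..n. inner h (grad (f k) x)) / real n)) (at x)"
    by (rule bounded_linear.has_derivative[OF bounded_linear_divide])
  then show ?thesis
    unfolding gderiv_def finite_avg_def[abs_def] by (simp add: inner_sum_right)
qed

lemma grad_F: "grad F x = (1 / real n) *\<^sub>R (\<Sum>k=1..n. grad (f k) x)"
  using GDERIV_F by (rule grad_eqI)

lemma bregman_F: "bregman F x y = (\<Sum>k=1..n. bregman (f k) x y) / real n"
  unfolding bregman_def grad_F
  by (simp add: finite_avg_def sum_subtractf inner_sum_left diff_divide_distrib)

lemma bregman_F_nonneg: "bregman F x y \<ge> 0"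
  unfolding bregman_F using convex_grad_le[OF cvx diff]
  by (intro divide_nonneg_nonneg sum_nonneg) (auto simp: bregman_def algebra_simps)

lemma bregman_F_le: "bregman F x y \<le> Lb / 2 * (norm (y - x))\<^sup>2"
proof -
  have "bregman (f k) x y \<le> L k * ((norm (y - x))\<^sup>2 / 2)" if "k \<in> {1..n}" for k
    using lipschitz_grad_upper_bound[OF diff[OF that] lip[OF that], of y x]
    by (simp add: bregman_def algebra_simps)
  then have "(\<Sum>k=1..n. bregman (f k) x y) \<le> (\<Sum>k=1..n. L k) * ((norm (y - x))\<^sup>2 / 2)"
    unfolding sum_distrib_right by (rule sum_mono)
  then show ?thesis
    unfolding bregman_F Lbar_def using n by (simp add: field_simps)
qed

text \<open>The optimality of \<open>xstar\<close> makes \<open>- grad F xstar\<close> a subgradient of \<open>R\<close>; so the linear part of the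
  Bregman divergence of \<open>F\<close> is compensated by \<open>R\<close>, and strong convexity leaves a quadratic gain.\<close>

lemma minus_grad_F_xstar: "- grad F xstar \<in> subdifferential R xstar"
  using R P_ge GDERIV_F unfolding grad_F strongly_convex_def
  by (intro subgradient_of_minimizer) auto

lemma bregman_F_xstar_le: "bregman F xstar x \<le> P x - P xstar - \<mu> / 2 * (norm (x - xstar))\<^sup>2"
proof -
  have "R xstar + inner (- grad F xstar) (x - xstar) + \<mu> / 2 * (norm (x - xstar))\<^sup>2 \<le> R x"
    using R minus_grad_F_xstar unfolding strongly_convex_def by blast
  then show ?thesis by (simp add: bregman_def)
qed

lemma vr_gradient_eq:
  assumes "k \<in> {1..n}"
  shows "vr_gradient n f L x0 u k = (Lb / L k) *\<^sub>R (grad (f k) u - grad (f k) x0) + grad F x0"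
  using n L_pos[OF assms] Lb_pos by (simp add: vr_gradient_def q_weight_def)

lemma vr_gradient_unbiased: "(\<Sum>k=1..n. q k *\<^sub>R vr_gradient n f L x0 u k) = grad F u"
proof -
  have "q k *\<^sub>R vr_gradient n f L x0 u k
      = (1 / real n) *\<^sub>R (grad (f k) u - grad (f k) x0) + q k *\<^sub>R grad F x0"
    if "k \<in> {1..n}" for k
    using that L_pos[OF that] Lb_pos by (simp add: vr_gradient_eq scaleR_add_right q_weight_def)
  then have "(\<Sum>k=1..n. q k *\<^sub>R vr_gradient n f L x0 u k)
      = (\<Sum>k=1..n. (1 / real n) *\<^sub>R (grad (f k) u - grad (f k) x0)) + (\<Sum>k=1..n. q k) *\<^sub>R grad F x0"
    by (simp add: sum.distrib scaleR_sum_left)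
  also have "\<dots> = grad F u"
    unfolding sum_q grad_F by (simp add: scaleR_sum_right[symmetric] sum_subtractf algebra_simps)
  finally show ?thesis .
qed

text \<open>Around its mean the estimate varies at most as much as around \<open>grad F x0\<close>, and passing through
  \<open>xstar\<close> splits the difference of the gradients at \<open>u\<close> and \<open>x0\<close> into two parts, each bounded by a
  Bregman divergence. The weights 3 and 3/2 in
  \<open>(norm (a + b))\<^sup>2 \<le> 3 * (norm a)\<^sup>2 + 3 / 2 * (norm b)\<^sup>2\<close> are those for which, after division by
  \<open>6 * Lb\<close>, the part at \<open>u\<close> has coefficient 1, which the convexity of \<open>F\<close> cancels exactly, and
  the part at \<open>x0\<close> has coefficient 1/2, the contraction factor of a stage.\<close>

lemma vr_gradient_variance:
  "(\<Sum>k=1..n. q k * (norm (vr_gradient n f L x0 u k - grad F u))\<^sup>2)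
     \<le> 6 * Lb * (bregman F u xstar + bregman F xstar x0 / 2)"
proof -
  have term_le: "q k * (norm (vr_gradient n f L x0 u k - grad F x0))\<^sup>2
      \<le> Lb / real n * (6 * bregman (f k) u xstar + 3 * bregman (f k) xstar x0)"
    if k: "k \<in> {1..n}" for k
  proof -
    define a where "a = grad (f k) xstar - grad (f k) u"
    define b where "b = grad (f k) x0 - grad (f k) xstar"
    note breg = grad_diff_le_bregman[OF cvx[OF k] diff[OF k] lip[OF k] L_pos[OF k]]
    have a: "(norm a)\<^sup>2 \<le> 2 * L k * bregman (f k) u xstar"
      unfolding a_def bregman_def by (rule breg)
    have b: "(norm b)\<^sup>2 \<le> 2 * L k * bregman (f k) xstar x0"
      unfolding b_def bregman_def by (rule breg)
    have "0 \<le> (norm (2 *\<^sub>R a - b))\<^sup>2 / 2"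
      by simp
    also have "\<dots> = 3 * (norm a)\<^sup>2 + 3 / 2 * (norm b)\<^sup>2 - (norm (a + b))\<^sup>2"
      unfolding power2_norm_eq_inner by (simp add: algebra_simps inner_commute add_divide_distrib diff_divide_distrib)
    finally have "(norm (a + b))\<^sup>2 \<le> L k * (6 * bregman (f k) u xstar + 3 * bregman (f k) xstar x0)"
      using a b by (simp add: algebra_simps)
    then have ab: "Lb / (real n * L k) * (norm (a + b))\<^sup>2 \<le> Lb / (real n * L k) * (L k * (6 * bregman (f k) u xstar + 3 * bregman (f k) xstar x0))"
      using Lb_pos L_pos[OF k] by (intro mult_left_mono) auto
    have "vr_gradient n f L x0 u k - grad F x0 = (Lb / L k) *\<^sub>R (- (a + b))"
      unfolding vr_gradient_eq[OF k] by (simp add: a_def b_def)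
    then have "norm (vr_gradient n f L x0 u k - grad F x0) = Lb / L k * norm (a + b)"
      using Lb_pos L_pos[OF k] by (simp only: norm_scaleR norm_minus_cancel) simp
    then have "q k * (norm (vr_gradient n f L x0 u k - grad F x0))\<^sup>2 = Lb / (real n * L k) * (norm (a + b))\<^sup>2"
      using Lb_pos L_pos[OF k] by (simp add: q_weight_def power_mult_distrib power2_eq_square)
    with ab L_pos[OF k] show ?thesis by simp
  qed
  have "(\<Sum>k=1..n. q k * (norm (vr_gradient n f L x0 u k - grad F u))\<^sup>2)
      \<le> (\<Sum>k=1..n. q k * (norm (vr_gradient n f L x0 u k - grad F x0))\<^sup>2)"
    by (rule weighted_variance_le[OF sum_q vr_gradient_unbiased])
  also have "\<dots> \<le> (\<Sum>k=1..n. Lb / real n * (6 * bregman (f k) u xstar + 3 * bregman (f k) xstar x0))"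
    by (rule sum_mono[OF term_le])
  also have "\<dots> = 6 * Lb * (bregman F u xstar + bregman F xstar x0 / 2)"
    unfolding bregman_F sum_distrib_left[symmetric] sum.distrib by (simp add: algebra_simps add_divide_distrib)
  finally show ?thesis .
qed

text \<open>What a draw \<open>k\<close> contributes to the bound for a stage. The vector \<open>w\<close> collects all that is paired
  with the error of the estimate; in an iteration it is known before the draw, so that the inner
  product has mean 0.\<close>

definition step_error :: "'a \<Rightarrow> 'a \<Rightarrow> 'a \<Rightarrow> nat \<Rightarrow> real" where
  "step_error x0 u w k =
     (norm (vr_gradient n f L x0 u k - grad F u))\<^sup>2 / (6 * Lb)
     + inner (vr_gradient n f L x0 u k - grad F u) w - bregman F u xstar"

lemma mean_step_error:
  "(\<Sum>k=1..n. q k * step_error x0 u w k) \<le> (P x0 - P xstar - \<mu> / 2 * (norm (x0 - xstar))\<^sup>2) / 2"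
proof -
  let ?d = "\<lambda>k. vr_gradient n f L x0 u k - grad F u"
  have "(\<Sum>k=1..n. q k *\<^sub>R ?d k) = 0"
    unfolding scaleR_diff_right sum_subtractf vr_gradient_unbiased scaleR_sum_left[symmetric] sum_q
    by simp
  then have "(\<Sum>k=1..n. q k * inner (?d k) w) = 0"
    using inner_sum_left[of "\<lambda>k. q k *\<^sub>R ?d k" "{1..n}" w] by simp
  then have "(\<Sum>k=1..n. q k * step_error x0 u w k)
      = (\<Sum>k=1..n. q k * (norm (?d k))\<^sup>2) / (6 * Lb) - (\<Sum>k=1..n. q k) * bregman F u xstar"
    unfolding step_error_def
    by (simp add: distrib_left right_diff_distrib sum.distrib sum_subtractf sum_divide_distrib sum_distrib_right)
  also have "\<dots> \<le> bregman F xstar x0 / 2"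
    using vr_gradient_variance[of x0 u] Lb_pos unfolding sum_q
    by (simp add: pos_divide_le_eq algebra_simps)
  also have "\<dots> \<le> (P x0 - P xstar - \<mu> / 2 * (norm (x0 - xstar))\<^sup>2) / 2"
    using bregman_F_xstar_le[of x0] by simp
  finally show ?thesis .
qed

end

section \<open>One stage for given draws\<close>

lemma inner_le_young:
  fixes e d :: "'a::real_inner"
  assumes "K > 0"
  shows "inner e d \<le> 3 * K / 2 * (norm d)\<^sup>2 + (norm e)\<^sup>2 / (6 * K)"
proof -
  have "0 \<le> (norm (e - (3 * K) *\<^sub>R d))\<^sup>2"
    by simp
  also have "\<dots> = (norm e)\<^sup>2 - 6 * K * inner e d + 9 * K\<^sup>2 * (norm d)\<^sup>2"
    unfolding power2_norm_eq_inner by (simp add: algebra_simps inner_commute power2_eq_square)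
  finally have "6 * K * inner e d \<le> 6 * K * (3 * K / 2 * (norm d)\<^sup>2 + (norm e)\<^sup>2 / (6 * K))"
    using assms by (simp add: algebra_simps power2_eq_square)
  then show ?thesis using assms by simp
qed

locale svrda_stage = svrda_problem +
  fixes x0 v0 :: 'a and i :: "nat \<Rightarrow> nat"
begin

definition gb :: "nat \<Rightarrow> 'a" where
  "gb t = fst (svrda_inner n f L R (4 * Lb) x0 v0 i t)"
definition x :: "nat \<Rightarrow> 'a" where
  "x t = fst (snd (svrda_inner n f L R (4 * Lb) x0 v0 i t))"
definition v :: "nat \<Rightarrow> 'a" where
  "v t = fst (snd (snd (svrda_inner n f L R (4 * Lb) x0 v0 i t)))"
definition u :: "nat \<Rightarrow> 'a" where
  "u t = snd (snd (snd (svrda_inner n f L R (4 * Lb) x0 v0 i t)))"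

text \<open>Index shift: \<open>g t\<close> is the estimate at \<open>u t\<close>, used in iteration \<open>Suc t\<close>.\<close>

definition g :: "nat \<Rightarrow> 'a" where
  "g t = vr_gradient n f L x0 (u t) (i (Suc t))"

lemma v_0: "v 0 = v0"
  by (simp add: v_def)

lemma gb_Suc: "gb (Suc t) = (1 - 1 / real (Suc t)) *\<^sub>R gb t + (1 / real (Suc t)) *\<^sub>R g t"
  by (simp add: gb_def g_def u_def Let_def split: prod.splits)

lemma v_Suc:
  "v (Suc t) = argmin (\<lambda>z. inner (gb (Suc t)) z + R z + 4 * Lb / (2 * real (Suc t)) * (norm (z - v0))\<^sup>2)"
  by (simp only: gb_def v_def svrda_inner.simps Let_def case_prod_beta fst_conv snd_conv)

lemma x_Suc:
  "x (Suc t) = argmin (\<lambda>z. inner (g t) z + R z + 4 * Lb * real (Suc t) / 2 * (norm (z - u t))\<^sup>2)"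
  by (simp only: x_def g_def u_def svrda_inner.simps Let_def case_prod_beta fst_conv snd_conv)

lemma u_eq: "u t = (1 - 1 / (real t + 1)) *\<^sub>R x t + (1 / (real t + 1)) *\<^sub>R v t"
  by (cases t) (simp_all add: x_def v_def u_def Let_def split: prod.splits)

lemma scaleR_gb: "real t *\<^sub>R gb t = (\<Sum>\<tau><t. g \<tau>)"
proof (induction t)
  case (Suc t)
  have "real (Suc t) *\<^sub>R gb (Suc t)
      = (real (Suc t) * (1 - 1 / real (Suc t))) *\<^sub>R gb t + (real (Suc t) * (1 / real (Suc t))) *\<^sub>R g t"
    unfolding gb_Suc scaleR_add_right scaleR_scaleR ..
  also have "real (Suc t) * (1 - 1 / real (Suc t)) = real t"
    by (simp add: field_simps)
  finally show ?case by (simp add: Suc.IH)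
qed simp

text \<open>The estimate function of dual averaging: the sum of the linearizations of \<open>F\<close> with the estimated
  gradients, plus \<open>R\<close>, regularized around \<open>v0\<close>. It is \<open>t\<close> times the objective of the \<open>v\<close>-step,
  up to a constant.\<close>

definition \<psi> :: "nat \<Rightarrow> 'a \<Rightarrow> real" where
  "\<psi> t z = (\<Sum>\<tau><t. F (u \<tau>) + inner (g \<tau>) (z - u \<tau>) + R z) + 2 * Lb * (norm (z - v0))\<^sup>2"

lemma \<psi>_Suc: "\<psi> (Suc t) z = \<psi> t z + F (u t) + inner (g t) (z - u t) + R z"
  by (simp add: \<psi>_def)

lemma \<psi>_v_le: "\<psi> t (v t) + (2 * Lb + real t * \<mu> / 2) * (norm (z - v t))\<^sup>2 \<le> \<psi> t z"
proof (cases t)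
  case 0
  then show ?thesis by (simp add: \<psi>_def v_0)
next
  case (Suc t')
  define \<phi> where "\<phi> z = inner (gb t) z + R z + 4 * Lb / (2 * real t) * (norm (z - v0))\<^sup>2" for z
  have t: "real t > 0"
    using Suc by simp
  have vt: "v t = argmin \<phi>"
    unfolding Suc v_Suc \<phi>_def ..
  have "\<phi> (argmin \<phi>) + (4 * Lb / (2 * real t) + \<mu> / 2) * (norm (z - argmin \<phi>))\<^sup>2 \<le> \<phi> z"
    unfolding \<phi>_def using t Lb_pos by (intro prox_argmin[OF R minus_grad_F_xstar]) auto
  then have scaled_le: "real t * (\<phi> (v t) + (4 * Lb / (2 * real t) + \<mu> / 2) * (norm (z - v t))\<^sup>2) \<le> real t * \<phi> z"
    unfolding vt[symmetric] using t by (intro mult_left_mono) auto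
  have scaled: "real t * \<phi> y = \<psi> t y - (\<Sum>\<tau><t. F (u \<tau>) - inner (g \<tau>) (u \<tau>))" for y
  proof -
    have "real t * inner (gb t) y = (\<Sum>\<tau><t. inner (g \<tau>) y)"
      using arg_cong[OF scaleR_gb, of "\<lambda>w. inner w y" t] by (simp add: inner_sum_left)
    then show ?thesis
      using t unfolding \<phi>_def \<psi>_def
      by (simp add: distrib_left sum.distrib sum_subtractf inner_diff_right)
  qed
  have "real t * (\<phi> (v t) + (4 * Lb / (2 * real t) + \<mu> / 2) * (norm (z - v t))\<^sup>2)
      = real t * \<phi> (v t) + (2 * Lb + real t * \<mu> / 2) * (norm (z - v t))\<^sup>2"
    using t by (simp add: field_simps)
  with scaled_le scaled[of z] scaled[of "v t"] show ?thesis by linarith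
qed

text \<open>The \<open>x\<close>-step beats the point \<open>y\<close> that arises from \<open>u t\<close> when \<open>v t\<close> is replaced by
  \<open>v (Suc t)\<close>; as \<open>y - u t\<close> is \<open>1 / Suc t\<close> times the move of \<open>v\<close>, the proximal term at \<open>y\<close> is
  paid for by the growth of the estimate function. Of the proximal term at \<open>x (Suc t)\<close>, with its
  coefficient \<open>2 * Lb * Suc t\<close>, smoothness uses \<open>Lb / 2\<close>; the rest absorbs the error of the
  gradient estimate.\<close>

lemma x_step:
  "real (Suc t) * P (x (Suc t)) \<le>
     real t * (F (u t) + inner (g t) (x t - u t) + R (x t))
     + (F (u t) + inner (g t) (v (Suc t) - u t) + R (v (Suc t)))
     + 2 * Lb * (norm (v (Suc t) - v t))\<^sup>2
     + (norm (g t - grad F (u t)))\<^sup>2 / (6 * Lb)"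
proof -
  define T where "T = real (Suc t)"
  define y where "y = (1 - 1 / T) *\<^sub>R x t + (1 / T) *\<^sub>R v (Suc t)"
  define d where "d = x (Suc t) - u t"
  define e where "e = g t - grad F (u t)"
  define \<phi> where "\<phi> z = inner (g t) z + R z + 4 * Lb * T / 2 * (norm (z - u t))\<^sup>2" for z
  have T: "T \<ge> 1" and T0: "T > 0" and t: "real t = T - 1"
    by (simp_all add: T_def)
  have xS: "x (Suc t) = argmin \<phi>"
    unfolding x_Suc \<phi>_def T_def ..
  have "\<phi> (argmin \<phi>) + (4 * Lb * T / 2 + \<mu> / 2) * (norm (y - argmin \<phi>))\<^sup>2 \<le> \<phi> y"
    unfolding \<phi>_def using T Lb_pos by (intro prox_argmin[OF R minus_grad_F_xstar]) auto
  moreover have "0 \<le> (4 * Lb * T / 2 + \<mu> / 2) * (norm (y - argmin \<phi>))\<^sup>2"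
    using T Lb_pos \<mu> by (intro mult_nonneg_nonneg) auto
  ultimately have prox: "\<phi> (x (Suc t)) \<le> \<phi> y"
    unfolding xS by linarith
  have u: "u t = (1 - 1 / T) *\<^sub>R x t + (1 / T) *\<^sub>R v t"
    unfolding u_eq T_def by (simp add: add.commute)
  have yu: "norm (y - u t) = norm (v (Suc t) - v t) / T"
  proof -
    have "y - u t = (1 / T) *\<^sub>R (v (Suc t) - v t)"
      by (simp add: y_def u scaleR_diff_right)
    then show ?thesis using T0 by simp
  qed
  have Ry: "R y \<le> (1 - 1 / T) * R (x t) + 1 / T * R (v (Suc t))"
    unfolding y_def using R T convex_onD[of UNIV R "1 / T" "x t" "v (Suc t)"]
    by (simp add: strongly_convex_def)
  have Rgy: "T * (inner (g t) y + R y)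
      \<le> real t * (inner (g t) (x t) + R (x t)) + (inner (g t) (v (Suc t)) + R (v (Suc t)))"
  proof -
    have "T * (inner (g t) y + R y)
        \<le> T * (inner (g t) y + ((1 - 1 / T) * R (x t) + 1 / T * R (v (Suc t))))"
      using Ry T0 by simp
    also have "\<dots> = real t * (inner (g t) (x t) + R (x t)) + (inner (g t) (v (Suc t)) + R (v (Suc t)))"
      using T0 unfolding y_def t by (simp add: inner_add_right field_simps)
    finally show ?thesis .
  qed
  have "F (x (Suc t)) \<le> F (u t) + inner (grad F (u t)) d + Lb / 2 * (norm d)\<^sup>2"
    using bregman_F_le[of "u t" "x (Suc t)"] by (simp add: bregman_def d_def)
  also have "inner (grad F (u t)) d = inner (g t) d + inner (- e) d"
    by (simp add: e_def inner_diff_left)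
  also have "inner (- e) d \<le> 3 * (Lb * T) / 2 * (norm d)\<^sup>2 + (norm (- e))\<^sup>2 / (6 * (Lb * T))"
    using Lb_pos T0 by (intro inner_le_young) simp
  also have "Lb / 2 * (norm d)\<^sup>2 \<le> Lb * T / 2 * (norm d)\<^sup>2"
    using Lb_pos T by (intro mult_right_mono) auto
  finally have "P (x (Suc t)) \<le> F (u t) - inner (g t) (u t) + \<phi> (x (Suc t)) + (norm e)\<^sup>2 / (6 * (Lb * T))"
    unfolding \<phi>_def d_def[symmetric] by (simp add: d_def inner_diff_right algebra_simps)
  also note prox
  finally have "T * P (x (Suc t)) \<le> T * (F (u t) - inner (g t) (u t) + \<phi> y + (norm e)\<^sup>2 / (6 * (Lb * T)))"
    using T0 by simp
  also have "\<dots> = T * (F (u t) - inner (g t) (u t)) + T * (inner (g t) y + R y)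
      + 2 * Lb * (norm (v (Suc t) - v t))\<^sup>2 + (norm e)\<^sup>2 / (6 * Lb)"
    using T0 Lb_pos unfolding \<phi>_def yu by (simp add: field_simps power2_eq_square)
  also note Rgy
  finally show ?thesis
    unfolding T_def[symmetric] e_def[symmetric] unfolding t
    by (simp add: inner_diff_right algebra_simps)
qed

text \<open>Convexity of \<open>F\<close> turns the linearization at \<open>u t\<close> in the previous bound into \<open>F (x t)\<close>, up to an
  error term of mean 0. The bound then telescopes, as the strong convexity of the estimate function
  pays for the movement of \<open>v\<close>.\<close>

lemma x_le_\<psi>_v:
  "real t * P (x t) \<le> \<psi> t (v t)
     + (\<Sum>\<tau><t. (norm (g \<tau> - grad F (u \<tau>)))\<^sup>2 / (6 * Lb)
          + inner (g \<tau> - grad F (u \<tau>)) (real \<tau> *\<^sub>R (x \<tau> - u \<tau>)))"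
proof (induction t)
  case 0
  then show ?case by (simp add: \<psi>_def v_0)
next
  case (Suc t)
  have "F (u t) + inner (grad F (u t)) (x t - u t) \<le> F (x t)"
    using bregman_F_nonneg[of "u t" "x t"] by (simp add: bregman_def)
  then have "real t * (F (u t) + inner (g t) (x t - u t) + R (x t))
      \<le> real t * (P (x t) + inner (g t - grad F (u t)) (x t - u t))"
    by (intro mult_left_mono) (auto simp: inner_diff_left)
  then have "real t * (F (u t) + inner (g t) (x t - u t) + R (x t))
      \<le> real t * P (x t) + inner (g t - grad F (u t)) (real t *\<^sub>R (x t - u t))"
    by (simp add: distrib_left)
  moreover have "2 * Lb * (norm (v (Suc t) - v t))\<^sup>2 \<le> (2 * Lb + real t * \<mu> / 2) * (norm (v (Suc t) - v t))\<^sup>2"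
    using \<mu> by (intro mult_right_mono) auto
  ultimately show ?case
    using x_step[of t] \<psi>_v_le[of t "v (Suc t)"] Suc.IH unfolding \<psi>_Suc sum.lessThan_Suc by linarith
qed

text \<open>Evaluating the estimate function at \<open>xstar\<close> produces the negative Bregman divergences inside
  \<^const>\<open>step_error\<close>.\<close>

lemma stage_bound:
  "real m * (P (x m) - P xstar) + (2 * Lb + real m * \<mu> / 2) * (norm (v m - xstar))\<^sup>2
     \<le> 2 * Lb * (norm (v0 - xstar))\<^sup>2
       + (\<Sum>t<m. step_error x0 (u t) (real t *\<^sub>R (x t - u t) + (xstar - u t)) (i (Suc t)))"
proof -
  have "F (u t) + inner (g t) (xstar - u t) + R xstar
      = P xstar + (inner (g t - grad F (u t)) (xstar - u t) - bregman F (u t) xstar)" for t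
    by (simp add: bregman_def inner_diff_left)
  then have "\<psi> m xstar = real m * P xstar
      + (\<Sum>t<m. inner (g t - grad F (u t)) (xstar - u t) - bregman F (u t) xstar)
      + 2 * Lb * (norm (v0 - xstar))\<^sup>2"
    unfolding \<psi>_def by (simp add: sum.distrib sum_subtractf norm_minus_commute distrib_left)
  moreover have "(\<Sum>t<m. step_error x0 (u t) (real t *\<^sub>R (x t - u t) + (xstar - u t)) (i (Suc t)))
      = (\<Sum>t<m. (norm (g t - grad F (u t)))\<^sup>2 / (6 * Lb)
          + inner (g t - grad F (u t)) (real t *\<^sub>R (x t - u t)))
      + (\<Sum>t<m. inner (g t - grad F (u t)) (xstar - u t) - bregman F (u t) xstar)"
    unfolding step_error_def g_def[symmetric] sum.distrib[symmetric]
    by (intro sum.cong refl) (simp add: inner_add_right)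
  ultimately show ?thesis
    using \<psi>_v_le[of m xstar] x_le_\<psi>_v[of m]
    by (simp add: norm_minus_commute right_diff_distrib)
qed

end

section \<open>Finitely many independent draws\<close>

definition determined_by :: "'i set \<Rightarrow> (('i \<Rightarrow> 'b) \<Rightarrow> 'c) \<Rightarrow> bool" where
  "determined_by J h \<longleftrightarrow> (\<forall>w w'. (\<forall>j\<in>J. w j = w' j) \<longrightarrow> h w = h w')"

lemma determined_by_restrict:
  assumes "determined_by J h"
  shows "h (restrict w J) = h w"
proof -
  have "\<forall>j\<in>J. restrict w J j = w j" by simp
  with assms show ?thesis unfolding determined_by_def by blast
qed

context prob_space
begin

lemma borel_measurable_finite_PiM:
  fixes h :: "('i \<Rightarrow> 'b) \<Rightarrow> real"
  assumes "finite A" and "finite J"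
  shows "h \<in> borel_measurable (Pi\<^sub>M J (\<lambda>_. count_space A))"
  using assms by (subst count_space_PiM_finite) (auto intro: countable_finite)

lemma integrable_finite_draws:
  fixes h :: "('i \<Rightarrow> 'b) \<Rightarrow> real"
  assumes A: "finite A" and J: "finite J" and h: "determined_by J h"
    and X: "\<And>j. j \<in> J \<Longrightarrow> random_variable (count_space A) (X j)"
  shows "integrable M (\<lambda>\<omega>. h (\<lambda>j. X j \<omega>))"
proof -
  define Y where "Y \<omega> = restrict (\<lambda>j. X j \<omega>) J" for \<omega>
  have h_Y: "h (\<lambda>j. X j \<omega>) = h (Y \<omega>)" for \<omega>
    unfolding Y_def determined_by_restrict[OF h] ..
  have Y: "Y \<in> measurable M (Pi\<^sub>M J (\<lambda>_. count_space A))"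
    unfolding Y_def using X by (rule measurable_restrict)
  let ?B = "Max ((\<lambda>w. \<bar>h w\<bar>) ` (J \<rightarrow>\<^sub>E A))"
  have "norm (h (Y \<omega>)) \<le> ?B" if "\<omega> \<in> space M" for \<omega>
  proof -
    have "Y \<omega> \<in> J \<rightarrow>\<^sub>E A"
      using measurable_space[OF Y that] by (simp add: space_PiM)
    then show ?thesis
      using A J by (auto intro!: Max_ge finite_PiE)
  qed
  then show ?thesis
    unfolding h_Y using measurable_compose[OF Y borel_measurable_finite_PiM[OF A J]]
    by (intro integrable_const_bound[of _ ?B]) auto
qed

text \<open>A finite-valued draw can be averaged out of a function of itself and of independent draws: split
  the function according to the value \<open>k\<close> of the draw and use independence for each \<open>k\<close>. This
  takes the place of conditioning on the past.\<close>

lemma expectation_independent_draw: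
  fixes h :: "('i \<Rightarrow> 'b) \<Rightarrow> 'b \<Rightarrow> real"
  assumes ind: "indep_vars (\<lambda>_. count_space A) X J'"
    and A: "finite A" and J: "finite J" "J \<subseteq> J'" and j: "j \<in> J'" "j \<notin> J"
    and h: "\<And>k. determined_by J (\<lambda>w. h w k)"
  shows "expectation (\<lambda>\<omega>. h (\<lambda>i. X i \<omega>) (X j \<omega>))
       = (\<Sum>k\<in>A. measure (distr M (count_space A) (X j)) {k} * expectation (\<lambda>\<omega>. h (\<lambda>i. X i \<omega>) k))"
proof -
  have X: "random_variable (count_space A) (X i)" if "i \<in> J'" for i
    using ind that by (simp add: indep_vars_def)
  have int_h: "integrable M (\<lambda>\<omega>. h (\<lambda>i. X i \<omega>) k)" for k
    by (rule integrable_finite_draws[OF A J(1) h]) (use X J in blast)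
  have int_ind: "integrable M (\<lambda>\<omega>. indicator {k} (X j \<omega>) :: real)" for k
    by (rule integrable_finite_draws[of A "{j}" "\<lambda>w. indicator {k} (w j)"])
       (use A X j in \<open>auto simp: determined_by_def\<close>)
  have ind_k: "indep_var borel (\<lambda>\<omega>. indicator {k} (X j \<omega>) :: real) borel (\<lambda>\<omega>. h (\<lambda>i. X i \<omega>) k)" for k
  proof -
    have "indep_var (PiM {j} (\<lambda>_. count_space A)) (\<lambda>\<omega>. restrict (\<lambda>i. X i \<omega>) {j})
        (PiM J (\<lambda>_. count_space A)) (\<lambda>\<omega>. restrict (\<lambda>i. X i \<omega>) J)"
      using ind j J by (intro indep_var_restrict) auto
    from indep_var_compose[OF this borel_measurable_finite_PiM[OF A] borel_measurable_finite_PiM[OF A J(1)],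
        of "\<lambda>w. indicator {k} (w j)" "\<lambda>w. h w k"]
    show ?thesis
      by (simp add: comp_def determined_by_restrict[OF h])
  qed
  have "expectation (\<lambda>\<omega>. h (\<lambda>i. X i \<omega>) (X j \<omega>))
      = expectation (\<lambda>\<omega>. \<Sum>k\<in>A. indicator {k} (X j \<omega>) * h (\<lambda>i. X i \<omega>) k)"
  proof (rule Bochner_Integration.integral_cong[OF refl])
    fix \<omega> assume "\<omega> \<in> space M"
    then have "X j \<omega> \<in> A"
      using measurable_space[OF X[OF j(1)]] by simp
    then show "h (\<lambda>i. X i \<omega>) (X j \<omega>) = (\<Sum>k\<in>A. indicator {k} (X j \<omega>) * h (\<lambda>i. X i \<omega>) k)"
      using A by (simp add: indicator_def if_distrib[of "\<lambda>x. x * _"] sum.delta' cong: if_cong)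
  qed
  also have "\<dots> = (\<Sum>k\<in>A. expectation (\<lambda>\<omega>. indicator {k} (X j \<omega>) * h (\<lambda>i. X i \<omega>) k))"
    by (intro Bochner_Integration.integral_sum indep_var_integrable ind_k int_ind int_h)
  also have "\<dots> = (\<Sum>k\<in>A. measure (distr M (count_space A) (X j)) {k} * expectation (\<lambda>\<omega>. h (\<lambda>i. X i \<omega>) k))"
  proof (rule sum.cong[OF refl])
    fix k assume k: "k \<in> A"
    have "expectation (\<lambda>\<omega>. indicator {k} (X j \<omega>) :: real) = measure (distr M (count_space A) (X j)) {k}"
    proof -
      have "expectation (\<lambda>\<omega>. indicator {k} (X j \<omega>) :: real) = integral\<^sup>L (distr M (count_space A) (X j)) (indicator {k})"
        using X[OF j(1)] by (subst integral_distr) auto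
      also have "\<dots> = measure (distr M (count_space A) (X j)) {k}"
        using k by simp
      finally show ?thesis .
    qed
    then show "expectation (\<lambda>\<omega>. indicator {k} (X j \<omega>) * h (\<lambda>i. X i \<omega>) k)
        = measure (distr M (count_space A) (X j)) {k} * expectation (\<lambda>\<omega>. h (\<lambda>i. X i \<omega>) k)"
      by (subst indep_var_lebesgue_integral[OF ind_k int_ind int_h]) simp
  qed
  finally show ?thesis .
qed

end

section \<open>Contraction of the potential over a stage\<close>

lemma svrda_inner_cong:
  assumes "\<And>\<tau>. \<tau> \<in> {1..t} \<Longrightarrow> i \<tau> = i' \<tau>"
  shows "svrda_inner n f L R \<eta> x0 v0 i t = svrda_inner n f L R \<eta> x0 v0 i' t"
  using assms
proof (induction t)
  case (Suc t)
  then have "svrda_inner n f L R \<eta> x0 v0 i t = svrda_inner n f L R \<eta> x0 v0 i' t" by simp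
  moreover have "i (Suc t) = i' (Suc t)" using Suc.prems by simp
  ultimately show ?case by (simp only: svrda_inner.simps)
qed simp

lemma svrda_cong:
  assumes "\<And>\<sigma> t. \<sigma> \<in> {1..s} \<Longrightarrow> t \<in> {1..m} \<Longrightarrow> i \<sigma> t = i' \<sigma> t"
  shows "svrda n f L R xt0 \<eta> m \<alpha> i s = svrda n f L R xt0 \<eta> m \<alpha> i' s"
  using assms
proof (induction s)
  case (Suc s)
  then have "svrda n f L R xt0 \<eta> m \<alpha> i s = svrda n f L R xt0 \<eta> m \<alpha> i' s" by simp
  moreover have "svrda_inner n f L R \<eta> x0 v0 (i (Suc s)) m = svrda_inner n f L R \<eta> x0 v0 (i' (Suc s)) m" for x0 v0
    using Suc.prems by (intro svrda_inner_cong) simp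
  ultimately show ?case by (simp only: svrda.simps)
qed simp

locale svrda_run = svrda_problem + prob_space M
  for M :: "'w measure" +
  fixes I :: "nat \<Rightarrow> nat \<Rightarrow> 'w \<Rightarrow> nat" and m :: nat and xt0 :: 'a
  assumes m: "m \<ge> 1" "real m = 2 * Lbar n L / \<mu>"
    and draws: "svrda_draws M n L m I"
begin

text \<open>The quantities of a run as functions of an arbitrary table \<open>w\<close> of draws, \<open>w (s, t)\<close> being the
  draw of iteration \<open>t\<close> of stage \<open>s\<close>.\<close>

definition xs :: "(nat \<times> nat \<Rightarrow> nat) \<Rightarrow> nat \<Rightarrow> 'a" where
  "xs w s = fst (svrda n f L R xt0 (4 * Lb) m (1 / 4) (\<lambda>s t. w (s, t)) s)"

definition vs :: "(nat \<times> nat \<Rightarrow> nat) \<Rightarrow> nat \<Rightarrow> 'a" where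
  "vs w s = snd (svrda n f L R xt0 (4 * Lb) m (1 / 4) (\<lambda>s t. w (s, t)) s)"

definition v_start :: "(nat \<times> nat \<Rightarrow> nat) \<Rightarrow> nat \<Rightarrow> 'a" where
  "v_start w s = (1 - 1 / 4) *\<^sub>R vs w s + (1 / 4) *\<^sub>R xs w s"

definition err :: "nat \<Rightarrow> nat \<Rightarrow> (nat \<times> nat \<Rightarrow> nat) \<Rightarrow> nat \<Rightarrow> real" where
  "err s t w k =
    (let (_, x, _, u) = svrda_inner n f L R (4 * Lb) (xs w s) (v_start w s) (\<lambda>t. w (Suc s, t)) t
     in step_error (xs w s) u (real t *\<^sub>R (x - u) + (xstar - u)) k)"

definition potential :: "(nat \<times> nat \<Rightarrow> nat) \<Rightarrow> nat \<Rightarrow> real" where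
  "potential w s = P (xs w s) - P xstar + 3 * \<mu> / 2 * (norm (vs w s - xstar))\<^sup>2"

definition err_bound :: "(nat \<times> nat \<Rightarrow> nat) \<Rightarrow> nat \<Rightarrow> real" where
  "err_bound w s = (P (xs w s) - P xstar - \<mu> / 2 * (norm (xs w s - xstar))\<^sup>2) / 2"

definition earlier :: "nat \<Rightarrow> nat \<Rightarrow> (nat \<times> nat) set" where
  "earlier s t = {1..s} \<times> {1..m} \<union> {Suc s} \<times> {1..t}"

lemma svrda_eq_of_earlier:
  assumes "\<forall>j\<in>earlier s t. w j = w' j"
  shows "xs w s = xs w' s" and "vs w s = vs w' s"
proof -
  have "svrda n f L R xt0 (4 * Lb) m (1 / 4) (\<lambda>s t. w (s, t)) s
      = svrda n f L R xt0 (4 * Lb) m (1 / 4) (\<lambda>s t. w' (s, t)) s"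
    using assms by (intro svrda_cong) (auto simp: earlier_def)
  then show "xs w s = xs w' s" and "vs w s = vs w' s"
    by (simp_all add: xs_def vs_def)
qed

lemma determined_by_err: "determined_by (earlier s t) (\<lambda>w. err s t w k)"
  unfolding determined_by_def
proof (intro allI impI)
  fix w w' :: "nat \<times> nat \<Rightarrow> nat"
  assume eq: "\<forall>j\<in>earlier s t. w j = w' j"
  note xv = svrda_eq_of_earlier[OF eq]
  then have "v_start w s = v_start w' s"
    by (simp add: v_start_def)
  moreover have "svrda_inner n f L R (4 * Lb) x0 v0 (\<lambda>t. w (Suc s, t)) t
      = svrda_inner n f L R (4 * Lb) x0 v0 (\<lambda>t. w' (Suc s, t)) t" for x0 v0
    using eq by (intro svrda_inner_cong) (auto simp: earlier_def)
  ultimately show "err s t w k = err s t w' k"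
    by (simp only: err_def xv)
qed

abbreviation draw :: "'w \<Rightarrow> nat \<times> nat \<Rightarrow> nat" where
  "draw \<omega> \<equiv> \<lambda>j. (case j of (s, t) \<Rightarrow> I s t) \<omega>"

lemma indep_draws: "indep_vars (\<lambda>_. count_space {1..n}) (\<lambda>(s, t). I s t) ({1..} \<times> {1..m})"
  using draws by (simp add: svrda_draws_def)

lemma prob_draw:
  assumes "s \<ge> 1" and "t \<in> {1..m}" and k: "k \<in> {1..n}"
  shows "measure (distr M (count_space {1..n}) (I s t)) {k} = q k"
proof -
  have "measure (distr M (count_space {1..n}) (I s t)) {k} = measure (Q_dist n L) {k}"
    using draws assms by (simp add: svrda_draws_def)
  also have "\<dots> = q k"
    unfolding Q_dist_def using q_nonneg k
    by (simp add: measure_def emeasure_point_measure_finite)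
  finally show ?thesis .
qed

lemma integrable_of_stage:
  fixes h :: "'a \<Rightarrow> 'a \<Rightarrow> real"
  shows "integrable M (\<lambda>\<omega>. h (xs (draw \<omega>) s) (vs (draw \<omega>) s))"
proof (rule integrable_finite_draws[of "{1..n}" "earlier s 0" "\<lambda>w. h (xs w s) (vs w s)"])
  show "determined_by (earlier s 0) (\<lambda>w. h (xs w s) (vs w s))"
    unfolding determined_by_def by (metis svrda_eq_of_earlier)
  show "random_variable (count_space {1..n}) (case j of (s, t) \<Rightarrow> I s t)" if "j \<in> earlier s 0" for j
    using indep_draws that by (auto simp: indep_vars_def earlier_def)
qed (auto simp: earlier_def)

lemma expectation_err_le:
  assumes t: "t < m"
  shows "integrable M (\<lambda>\<omega>. err s t (draw \<omega>) (I (Suc s) (Suc t) \<omega>))"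
    and "expectation (\<lambda>\<omega>. err s t (draw \<omega>) (I (Suc s) (Suc t) \<omega>)) \<le> expectation (\<lambda>\<omega>. err_bound (draw \<omega>) s)"
proof -
  let ?X = "\<lambda>(s, t). I s t"
  have X: "random_variable (count_space {1..n}) (?X j)" if "j \<in> {1..} \<times> {1..m}" for j
    using indep_draws that by (auto simp: indep_vars_def)
  have sub: "insert (Suc s, Suc t) (earlier s t) \<subseteq> {1..} \<times> {1..m}"
    using t by (auto simp: earlier_def)
  have fin: "finite (earlier s t)"
    by (simp add: earlier_def)
  have int_err: "integrable M (\<lambda>\<omega>. err s t (draw \<omega>) k)" for k
    using X sub by (intro integrable_finite_draws[of "{1..n}", OF _ fin determined_by_err]) auto
  have det: "determined_by (insert (Suc s, Suc t) (earlier s t)) (\<lambda>w. err s t w (w (Suc s, Suc t)))"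
    using determined_by_err[of s t] unfolding determined_by_def by (metis insert_iff)
  have "integrable M (\<lambda>\<omega>. err s t (draw \<omega>) (draw \<omega> (Suc s, Suc t)))"
    by (rule integrable_finite_draws[of "{1..n}" _ _ ?X, OF _ _ det]) (use X sub fin in blast)+
  then show "integrable M (\<lambda>\<omega>. err s t (draw \<omega>) (I (Suc s) (Suc t) \<omega>))"
    by simp
  have "expectation (\<lambda>\<omega>. err s t (draw \<omega>) (I (Suc s) (Suc t) \<omega>))
      = (\<Sum>k\<in>{1..n}. measure (distr M (count_space {1..n}) (I (Suc s) (Suc t))) {k}
           * expectation (\<lambda>\<omega>. err s t (draw \<omega>) k))"
    using expectation_independent_draw[where h = "err s t" and X = ?X and j = "(Suc s, Suc t)",
        OF indep_draws finite_atLeastAtMost fin _ _ _ determined_by_err] sub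
    by (simp add: earlier_def)
  also have "\<dots> = (\<Sum>k=1..n. q k * expectation (\<lambda>\<omega>. err s t (draw \<omega>) k))"
    using t by (intro sum.cong refl) (subst prob_draw, auto)
  also have "\<dots> = expectation (\<lambda>\<omega>. \<Sum>k=1..n. q k * err s t (draw \<omega>) k)"
    using int_err by simp
  also have "\<dots> \<le> expectation (\<lambda>\<omega>. err_bound (draw \<omega>) s)"
  proof (rule integral_mono)
    show "integrable M (\<lambda>\<omega>. err_bound (draw \<omega>) s)"
      unfolding err_bound_def by (rule integrable_of_stage)
    show "(\<Sum>k=1..n. q k * err s t (draw \<omega>) k) \<le> err_bound (draw \<omega>) s" for \<omega>
      unfolding err_def err_bound_def Let_def case_prod_beta by (rule mean_step_error)
  qed (use int_err in auto)
  finally show "expectation (\<lambda>\<omega>. err s t (draw \<omega>) (I (Suc s) (Suc t) \<omega>)) \<le> expectation (\<lambda>\<omega>. err_bound (draw \<omega>) s)" .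
qed

text \<open>With \<open>2 * Lb = m * \<mu>\<close>, the stage bound divided by \<open>m\<close> has the potential of the next stage on its
  left. The start point of \<open>v\<close> is the mixture of \<open>vs\<close> and \<open>xs\<close> with weights 3/4 and 1/4: the
  first part has coefficient \<open>3 / 4 * \<mu>\<close>, half of that in the potential, and the second one
  cancels the quadratic term of \<open>err_bound\<close>.\<close>

lemma potential_Suc_le:
  "potential w (Suc s) \<le>
     potential w s / 2 - err_bound w s + (\<Sum>t<m. err s t w (w (Suc s, Suc t))) / real m"
proof -
  interpret S: svrda_stage n f L R \<mu> xstar "xs w s" "v_start w s" "\<lambda>t. w (Suc s, t)"
    by unfold_locales
  have Lb: "2 * Lb = real m * \<mu>"
    using m \<mu> by simp
  have m0: "real m > 0"
    using m by simp
  have S: "xs w (Suc s) = S.x m" "vs w (Suc s) = S.v m"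
    unfolding S.x_def S.v_def
    unfolding v_start_def xs_def vs_def svrda.simps Let_def case_prod_beta by simp_all
  have "real m * (P (xs w (Suc s)) - P xstar) + (2 * Lb + real m * \<mu> / 2) * (norm (vs w (Suc s) - xstar))\<^sup>2
      \<le> 2 * Lb * (norm (v_start w s - xstar))\<^sup>2 + (\<Sum>t<m. err s t w (w (Suc s, Suc t)))"
    using S.stage_bound[of m] unfolding S err_def S.x_def S.u_def Let_def case_prod_beta .
  also have "real m * (P (xs w (Suc s)) - P xstar) + (2 * Lb + real m * \<mu> / 2) * (norm (vs w (Suc s) - xstar))\<^sup>2
      = real m * potential w (Suc s)"
    unfolding Lb potential_def by (simp add: algebra_simps)
  also have "(norm (v_start w s - xstar))\<^sup>2
      \<le> 3 / 4 * (norm (vs w s - xstar))\<^sup>2 + 1 / 4 * (norm (xs w s - xstar))\<^sup>2"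
  proof -
    define a b where "a = vs w s - xstar" and "b = xs w s - xstar"
    have "v_start w s - xstar = (3 / 4) *\<^sub>R a + (1 / 4) *\<^sub>R b"
    proof -
      have "v_start w s - xstar = v_start w s - ((3 / 4) *\<^sub>R xstar + (1 / 4) *\<^sub>R xstar)"
        by (simp flip: scaleR_add_left)
      also have "\<dots> = (3 / 4) *\<^sub>R a + (1 / 4) *\<^sub>R b"
        unfolding a_def b_def v_start_def by (simp add: scaleR_diff_right)
      finally show ?thesis .
    qed
    moreover have "(norm ((3 / 4) *\<^sub>R a + (1 / 4) *\<^sub>R b))\<^sup>2 \<le> 3 / 4 * (norm a)\<^sup>2 + 1 / 4 * (norm b)\<^sup>2"
    proof -
      have "0 \<le> 3 / 16 * (norm (a - b))\<^sup>2"
        by simp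
      also have "3 / 16 * (norm (a - b))\<^sup>2
        = 3 / 4 * (norm a)\<^sup>2 + 1 / 4 * (norm b)\<^sup>2 - (norm ((3 / 4) *\<^sub>R a + (1 / 4) *\<^sub>R b))\<^sup>2"
        unfolding power2_norm_eq_inner by (simp add: algebra_simps inner_commute)
      finally show ?thesis by simp
    qed
    ultimately show ?thesis
      unfolding a_def b_def by simp
  qed
  then have "2 * Lb * (norm (v_start w s - xstar))\<^sup>2
      \<le> real m * \<mu> * (3 / 4 * (norm (vs w s - xstar))\<^sup>2 + 1 / 4 * (norm (xs w s - xstar))\<^sup>2)"
    unfolding Lb using \<mu> by (intro mult_left_mono) auto
  also have "\<dots> = real m * (potential w s / 2 - err_bound w s)"
    by (simp add: potential_def err_bound_def field_simps)
  finally have "real m * potential w (Suc s)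
      \<le> real m * (potential w s / 2 - err_bound w s) + (\<Sum>t<m. err s t w (w (Suc s, Suc t)))"
    by simp
  then show ?thesis
    using m0 by (simp add: field_simps)
qed

lemma expectation_potential_Suc:
  "expectation (\<lambda>\<omega>. potential (draw \<omega>) (Suc s)) \<le> expectation (\<lambda>\<omega>. potential (draw \<omega>) s) / 2"
proof -
  let ?err = "\<lambda>t \<omega>. err s t (draw \<omega>) (I (Suc s) (Suc t) \<omega>)"
  have int: "integrable M (\<lambda>\<omega>. potential (draw \<omega>) s)" "integrable M (\<lambda>\<omega>. err_bound (draw \<omega>) s)" for s
    unfolding potential_def err_bound_def by (rule integrable_of_stage)+
  have int_err: "integrable M (\<lambda>\<omega>. \<Sum>t<m. ?err t \<omega>)"
    using expectation_err_le(1) by (intro Bochner_Integration.integrable_sum) auto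
  have "expectation (\<lambda>\<omega>. \<Sum>t<m. ?err t \<omega>) = (\<Sum>t<m. expectation (?err t))"
    using expectation_err_le(1) by (intro Bochner_Integration.integral_sum) auto
  also have "\<dots> \<le> (\<Sum>t<m. expectation (\<lambda>\<omega>. err_bound (draw \<omega>) s))"
    using expectation_err_le(2) by (intro sum_mono) auto
  finally have err: "expectation (\<lambda>\<omega>. \<Sum>t<m. ?err t \<omega>) / real m \<le> expectation (\<lambda>\<omega>. err_bound (draw \<omega>) s)"
    using m(1) by (simp add: field_simps)
  have "expectation (\<lambda>\<omega>. potential (draw \<omega>) (Suc s))
      \<le> expectation (\<lambda>\<omega>. potential (draw \<omega>) s / 2 - err_bound (draw \<omega>) s + (\<Sum>t<m. ?err t \<omega>) / real m)"
    using potential_Suc_le[of "draw _" s] int int_err by (intro integral_mono) auto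
  also have "\<dots> = expectation (\<lambda>\<omega>. potential (draw \<omega>) s) / 2 - expectation (\<lambda>\<omega>. err_bound (draw \<omega>) s)
      + expectation (\<lambda>\<omega>. \<Sum>t<m. ?err t \<omega>) / real m"
    using int int_err by simp
  finally show ?thesis using err by simp
qed

lemma expectation_potential:
  "expectation (\<lambda>\<omega>. potential (draw \<omega>) s)
     \<le> (P xt0 - P xstar + 3 * \<mu> / 2 * (norm (xt0 - xstar))\<^sup>2) / 2 ^ s"
proof (induction s)
  case 0
  then show ?case by (simp add: potential_def xs_def vs_def prob_space)
next
  case (Suc s)
  have "expectation (\<lambda>\<omega>. potential (draw \<omega>) (Suc s)) \<le> expectation (\<lambda>\<omega>. potential (draw \<omega>) s) / 2"
    by (rule expectation_potential_Suc)
  also have "\<dots> \<le> (P xt0 - P xstar + 3 * \<mu> / 2 * (norm (xt0 - xstar))\<^sup>2) / 2 ^ s / 2"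
    using Suc.IH by (rule divide_right_mono) simp
  finally show ?case by (simp only: divide_divide_eq_left power_Suc2)
qed

end

section \<open>Number of stages\<close>

text \<open>The logarithm of \<open>(1 + D) / \<delta>\<close> to base 2, rounded up, serves as \<open>S\<close>. The summand 1 keeps
  the logarithm positive for small \<open>D\<close> and gives the bound \<open>ln (1 + D) \<le> D\<close>; since
  \<open>ln (1 / \<delta>)\<close> is at least \<open>2 / 3\<close>, terms without this factor can be multiplied by it.\<close>

lemma few_halvings:
  fixes D \<delta> :: real
  assumes D: "D \<ge> 0" and \<delta>: "0 < \<delta>" "\<delta> \<le> 1 / 2"
  shows "\<exists>S::nat. S \<ge> 1 \<and> D / 2 ^ S \<le> \<delta> \<and> real S \<le> 4 * (1 + D) * ln (1 / \<delta>)"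
proof -
  define l where "l = ln (1 / \<delta>)"
  have ln2: "ln 2 \<ge> (2 / 3 :: real)"
    using ln2_ge_two_thirds by simp
  have "ln 2 \<le> l"
    unfolding l_def using \<delta> by (subst ln_le_cancel_iff) (auto simp: field_simps)
  with ln2 have l: "l \<ge> 2 / 3" by simp
  define r where "r = log 2 ((1 + D) / \<delta>)"
  define S where "S = nat \<lceil>r\<rceil>"
  have "(1 + D) / \<delta> \<ge> 2"
    using D \<delta> by (simp add: pos_le_divide_eq)
  then have r1: "r \<ge> 1"
    unfolding r_def using \<delta> D by (subst one_le_log_cancel_iff) auto
  have S: "r \<le> real S" "real S \<le> r + 1"
    unfolding S_def using r1 by linarith+
  have "(1 + D) / \<delta> = 2 powr r"
    unfolding r_def using D \<delta> by simp
  also have "\<dots> \<le> 2 powr real S"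
    using S by simp
  finally have "(1 + D) / \<delta> \<le> 2 ^ S"
    by (simp add: powr_realpow)
  then have "D / 2 ^ S \<le> \<delta>"
    using \<delta> by (simp add: field_simps)
  moreover have "real S \<le> 4 * (1 + D) * l"
  proof -
    have "r * ln 2 = ln (1 + D) + l"
      unfolding r_def l_def log_def using D \<delta> by (simp add: ln_div)
    also have "\<dots> \<le> D + l"
      using ln_add_one_self_le_self[OF D] by simp
    finally have "r * (2 / 3) \<le> D + l"
      using mult_left_mono[OF ln2, of r] r1 by linarith
    then have "r + 1 \<le> 3 / 2 * D + 3 / 2 * l + 1"
      by simp
    also have "1 \<le> 3 / 2 * l"
      using l by simp
    also have "3 / 2 * D \<le> 4 * D * l"
      using mult_left_mono[OF l D] D by (simp add: algebra_simps)
    finally show ?thesis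
      using S l by (simp add: algebra_simps)
  qed
  moreover have "S \<ge> 1"
    using r1 S by linarith
  ultimately show ?thesis
    unfolding l_def by blast
qed

theorem corollary5p2:
  fixes n :: nat and f :: "nat \<Rightarrow> 'a::euclidean_space \<Rightarrow> real" and L :: "nat \<Rightarrow> real"
    and R P :: "'a \<Rightarrow> real" and \<mu> \<eta> \<alpha> D :: real and m1 :: nat and xt0 xstar :: 'a
    and M :: "'w measure" and I :: "nat \<Rightarrow> nat \<Rightarrow> 'w \<Rightarrow> nat"
    and xt vt :: "nat \<Rightarrow> 'w \<Rightarrow> 'a"
  assumes "n \<ge> 1"
    and "\<And>k. k \<in> {1..n} \<Longrightarrow> convex_on UNIV (f k)"
    and "\<And>k x. k \<in> {1..n} \<Longrightarrow> f k differentiable (at x)"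
    and "\<And>k. k \<in> {1..n} \<Longrightarrow> L k > 0"
    and "\<And>k. k \<in> {1..n} \<Longrightarrow> (L k)-lipschitz_on UNIV (grad (f k))"
    and "\<mu> > 0" and "strongly_convex \<mu> R"
    and P_def: "P = (\<lambda>x. finite_avg n f x + R x)"
    and "minimizer P xstar"
    and "\<eta> = 4 * Lbar n L"
    and "m1 \<ge> 1" and "real m1 = \<eta> / (2 * \<mu>)"
    and "\<alpha> = 1 / 4"
    and "prob_space M" and "svrda_draws M n L m1 I"
    and xt_def: "xt = (\<lambda>s \<omega>. fst (svrda n f L R xt0 \<eta> m1 \<alpha> (\<lambda>s t. I s t \<omega>) s))"
    and vt_def: "vt = (\<lambda>s \<omega>. snd (svrda n f L R xt0 \<eta> m1 \<alpha> (\<lambda>s t. I s t \<omega>) s))"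
    and D_def: "D = P xt0 - P xstar + 3 * \<mu> / 2 * (norm (xt0 - xstar))\<^sup>2"
  shows "(\<forall>S. prob_space.expectation M (\<lambda>\<omega>. P (xt S \<omega>) - P xstar)
            + 3 * \<mu> / 2 * prob_space.expectation M (\<lambda>\<omega>. (norm (vt S \<omega> - xstar))\<^sup>2)
          \<le> 1 / 2 ^ S * (P xt0 - P xstar + 3 * \<mu> / 2 * (norm (xt0 - xstar))\<^sup>2))
    \<and> (\<forall>\<epsilon>. 0 < \<epsilon> \<and> \<epsilon> \<le> 1 / 2 \<longrightarrow>
         (\<exists>S\<ge>1. prob_space.expectation M (\<lambda>\<omega>. P (xt S \<omega>) - P xstar) \<le> \<epsilon> \<and>
            real (gradient_evaluations n m1 S)
              \<le> complexity_const D * (real n + Lbar n L / \<mu>) * ln (1 / \<epsilon>)))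
    \<and> (\<forall>\<epsilon>. 0 < \<epsilon> \<and> \<mu> * \<epsilon> \<le> 1 / 2 \<longrightarrow>
         (\<exists>S\<ge>1. prob_space.expectation M (\<lambda>\<omega>. (norm (vt S \<omega> - xstar))\<^sup>2) \<le> \<epsilon> \<and>
            real (gradient_evaluations n m1 S)
              \<le> complexity_const D * (real n + Lbar n L / \<mu>) * ln (1 / (\<mu> * \<epsilon>))))"
proof -
  have \<mu>: "\<mu> > 0" and \<eta>: "\<eta> = 4 * Lbar n L" and \<alpha>: "\<alpha> = 1 / 4"
    by fact+
  interpret svrda_problem n f L R \<mu> xstar
    using assms by unfold_locales (auto simp: P_def)
  interpret prob_space M by fact
  have m1: "real m1 = 2 * Lbar n L / \<mu>"
    using assms by simp
  interpret svrda_run n f L R \<mu> xstar M I m1 xt0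
    using assms m1 by unfold_locales auto
  have xt: "xt S \<omega> = xs (draw \<omega>) S" and vt: "vt S \<omega> = vs (draw \<omega>) S" for S \<omega>
    unfolding xt_def vt_def xs_def vs_def \<eta> \<alpha> by simp_all
  have int_gap: "integrable M (\<lambda>\<omega>. P (xt S \<omega>) - P xstar)" for S
    unfolding xt P_def by (rule integrable_of_stage)
  have int_dist: "integrable M (\<lambda>\<omega>. (norm (vt S \<omega> - xstar))\<^sup>2)" for S
    unfolding vt by (rule integrable_of_stage)
  define gap where "gap S = expectation (\<lambda>\<omega>. P (xt S \<omega>) - P xstar)" for S
  define dist2 where "dist2 S = expectation (\<lambda>\<omega>. (norm (vt S \<omega> - xstar))\<^sup>2)" for S
  have "gap S + 3 * \<mu> / 2 * dist2 S = expectation (\<lambda>\<omega>. potential (draw \<omega>) S)" for S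
  proof -
    have "gap S + 3 * \<mu> / 2 * dist2 S
        = expectation (\<lambda>\<omega>. (P (xt S \<omega>) - P xstar) + 3 * \<mu> / 2 * (norm (vt S \<omega> - xstar))\<^sup>2)"
      unfolding gap_def dist2_def using int_gap int_dist by simp
    then show ?thesis
      by (simp add: potential_def xt vt P_def)
  qed
  then have rate: "gap S + 3 * \<mu> / 2 * dist2 S \<le> D / 2 ^ S" for S
    using expectation_potential[of S] by (simp add: D_def P_def)
  have gap_nonneg: "gap S \<ge> 0" for S
    unfolding gap_def P_def by (rule Bochner_Integration.integral_nonneg) (use P_ge in simp)
  have dist2_nonneg: "dist2 S \<ge> 0" for S
    unfolding dist2_def by (rule Bochner_Integration.integral_nonneg) simp
  have D: "D \<ge> 0"
    using P_ge[of xt0] \<mu> by (simp add: D_def P_def)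
  have cost: "real (gradient_evaluations n m1 S)
      \<le> complexity_const D * (real n + Lbar n L / \<mu>) * ln (1 / \<delta>)"
    if S: "real S \<le> 4 * (1 + D) * ln (1 / \<delta>)" for S \<delta>
  proof -
    have nL: "0 \<le> real n + Lbar n L / \<mu>"
      using Lb_pos \<mu> by simp
    have "real (gradient_evaluations n m1 S) = real S * (real n + 4 * (Lbar n L / \<mu>))"
      by (simp add: gradient_evaluations_def m1)
    also have "\<dots> \<le> real S * (4 * (real n + Lbar n L / \<mu>))"
      by (intro mult_left_mono) auto
    also have "\<dots> \<le> (4 * (1 + D) * ln (1 / \<delta>)) * (4 * (real n + Lbar n L / \<mu>))"
      using S nL by (intro mult_right_mono) auto
    also have "\<dots> = complexity_const D * (real n + Lbar n L / \<mu>) * ln (1 / \<delta>)"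
      by (simp add: complexity_const_def algebra_simps)
    finally show ?thesis .
  qed
  have "\<forall>S. gap S + 3 * \<mu> / 2 * dist2 S
      \<le> 1 / 2 ^ S * (P xt0 - P xstar + 3 * \<mu> / 2 * (norm (xt0 - xstar))\<^sup>2)"
    using rate by (simp add: D_def)
  moreover have "\<exists>S\<ge>1. gap S \<le> \<epsilon> \<and> real (gradient_evaluations n m1 S)
      \<le> complexity_const D * (real n + Lbar n L / \<mu>) * ln (1 / \<epsilon>)"
    if "0 < \<epsilon> \<and> \<epsilon> \<le> 1 / 2" for \<epsilon>
  proof -
    obtain S where S: "S \<ge> 1" "D / 2 ^ S \<le> \<epsilon>" "real S \<le> 4 * (1 + D) * ln (1 / \<epsilon>)"
      using few_halvings[OF D] \<open>0 < \<epsilon> \<and> \<epsilon> \<le> 1 / 2\<close> by blast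
    have "0 \<le> 3 * \<mu> / 2 * dist2 S"
      using dist2_nonneg \<mu> by simp
    with rate[of S] S(2) have "gap S \<le> \<epsilon>" by linarith
    with S(1) cost[OF S(3)] show ?thesis by blast
  qed
  moreover have "\<exists>S\<ge>1. dist2 S \<le> \<epsilon> \<and> real (gradient_evaluations n m1 S)
      \<le> complexity_const D * (real n + Lbar n L / \<mu>) * ln (1 / (\<mu> * \<epsilon>))"
    if "0 < \<epsilon> \<and> \<mu> * \<epsilon> \<le> 1 / 2" for \<epsilon>
  proof -
    obtain S where S: "S \<ge> 1" "D / 2 ^ S \<le> \<mu> * \<epsilon>" "real S \<le> 4 * (1 + D) * ln (1 / (\<mu> * \<epsilon>))"
      using few_halvings[OF D, of "\<mu> * \<epsilon>"] \<open>0 < \<epsilon> \<and> \<mu> * \<epsilon> \<le> 1 / 2\<close> \<mu> by auto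
    have "0 \<le> \<mu> * dist2 S"
      using dist2_nonneg \<mu> by simp
    moreover have "3 * \<mu> / 2 * dist2 S = 3 / 2 * (\<mu> * dist2 S)"
      by simp
    ultimately have "\<mu> * dist2 S \<le> \<mu> * \<epsilon>"
      using rate[of S] gap_nonneg[of S] S(2) by linarith
    then have "dist2 S \<le> \<epsilon>"
      using \<mu> by simp
    with S(1) cost[OF S(3)] show ?thesis by blast
  qed
  ultimately show ?thesis
    unfolding gap_def dist2_def by blast
qed

end
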